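(* Let $n\ge 1$, $t_0\in\mathbb{R}$, and let $P,Q,R,S:[t_0,+\infty)\to\mathbb{C}^{n\times n}$ be continuous. Let $t_1\ge t_0$ and let $Z(t)$ be a $t_1$-regular solution of the matrix Riccati equation $$Z'+ZP(t)Z+Q(t)Z+ZR(t)+S(t)=0,\qquad t\ge t_0. \quad (\mathrm{E})$$ Then $Z(t)$ is $t_1$-normal if and only if the matrix function $t\mapsto\mu_Z(t_1,t)$ is bounded on $[t_1,+\infty)$.
   Context: Standing assumption: equation (E) has at least two regular solutions from some initial time on, i.e. there is some $t_1'\ge t_0$ for which (E) has at least two $t_1'$-regular solutions. A solution $Z(t)$ of (E) is called $t_1$-regular if it exists on $[t_1,+\infty)$. A $t_1$-regular solution $Z(t)$ is called $t_1$-normal if there exists a neighborhood $U(Z(t_1))$ of $Z(t_1)$ in $\mathbb{C}^{n\times n}$ such that every solution $\widetilde Z(t)$ of (E) with $\widetilde Z(t_1)\in U(Z(t_1))$ is also $t_1$-regular; otherwise $Z(t)$ is called $t_1$-extremal. For a $t_1$-regular solution $Z(t)$ of (E), $\phi_Z(t)$ and $\psi_Z(t)$ denote the solutions on $[t_1,+\infty)$ of the linear matrix equations $$\phi'=[P(t)Z(t)+R(t)]\phi,\qquad \psi'=\psi[Z(t)P(t)+Q(t)]$$ with $\phi_Z(t_1)=\psi_Z(t_1)=I$ (the $n\times n$ identity matrix); both are invertible for all $t\ge t_1$. Further, $$\mu_Z(t_1,t)=\int_{t_1}^{t}\phi_Z^{-1}(\tau)P(\tau)\psi_Z^{-1}(\tau)\,d\tau,\qquad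 t\ge t_1.$$ *)

theory Defs
  imports "HOL-Analysis.Analysis"
begin

type_synonym 'n cmat = "complex^'n^'n"

text \<open>\<open>Z\<close> solves \<open>Z' + ZPZ + QZ + ZR + S = 0\<close> on the interval \<open>J\<close>; the derivative is one-sided at
  end points of \<open>J\<close> belonging to \<open>J\<close>. Values of \<open>Z\<close> outside \<open>J\<close> are irrelevant.\<close>

definition riccati_solution_on ::
  "(real \<Rightarrow> 'n::finite cmat) \<Rightarrow> (real \<Rightarrow> 'n cmat) \<Rightarrow> (real \<Rightarrow> 'n cmat) \<Rightarrow> (real \<Rightarrow> 'n cmat)
    \<Rightarrow> real set \<Rightarrow> (real \<Rightarrow> 'n cmat) \<Rightarrow> bool" where
  "riccati_solution_on P Q R S J Z \<longleftrightarrow>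
    (\<forall>t\<in>J. \<exists>Z'. (Z has_vector_derivative Z') (at t within J) \<and>
       Z' + Z t ** P t ** Z t + Q t ** Z t + Z t ** R t + S t = 0)"

definition regular_solution ::
  "(real \<Rightarrow> 'n::finite cmat) \<Rightarrow> (real \<Rightarrow> 'n cmat) \<Rightarrow> (real \<Rightarrow> 'n cmat) \<Rightarrow> (real \<Rightarrow> 'n cmat)
    \<Rightarrow> real \<Rightarrow> (real \<Rightarrow> 'n cmat) \<Rightarrow> bool" where
  "regular_solution P Q R S t1 Z \<longleftrightarrow> riccati_solution_on P Q R S {t1..} Z"

text \<open>In the definition of normality a competing solution \<open>W\<close> is a priori given only on some
  interval \<open>[t1, b)\<close>; that it is regular means that it exists on all of \<open>[t1, \<infinity>)\<close>, i.e. that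
  it continues to a solution there.\<close>

definition normal_solution ::
  "(real \<Rightarrow> 'n::finite cmat) \<Rightarrow> (real \<Rightarrow> 'n cmat) \<Rightarrow> (real \<Rightarrow> 'n cmat) \<Rightarrow> (real \<Rightarrow> 'n cmat)
    \<Rightarrow> real \<Rightarrow> (real \<Rightarrow> 'n cmat) \<Rightarrow> bool" where
  "normal_solution P Q R S t1 Z \<longleftrightarrow>
    regular_solution P Q R S t1 Z \<and>
    (\<exists>U. open U \<and> Z t1 \<in> U \<and>
      (\<forall>b W. t1 < b \<longrightarrow> riccati_solution_on P Q R S {t1..<b} W \<longrightarrow> W t1 \<in> U \<longrightarrow>
        (\<exists>V. regular_solution P Q R S t1 V \<and> (\<forall>t\<in>{t1..<b}. V t = W t))))"

text \<open>Regular solutions are functions on \<open>[t1, \<infinity>)\<close>, so two of them are distinct only if they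
  differ at a point of that half-line.\<close>

definition has_two_regular_solutions ::
  "(real \<Rightarrow> 'n::finite cmat) \<Rightarrow> (real \<Rightarrow> 'n cmat) \<Rightarrow> (real \<Rightarrow> 'n cmat) \<Rightarrow> (real \<Rightarrow> 'n cmat)
    \<Rightarrow> real \<Rightarrow> bool" where
  "has_two_regular_solutions P Q R S t1 \<longleftrightarrow>
    (\<exists>Z1 Z2. regular_solution P Q R S t1 Z1 \<and> regular_solution P Q R S t1 Z2 \<and>
      (\<exists>t\<ge>t1. Z1 t \<noteq> Z2 t))"

definition is_phi ::
  "(real \<Rightarrow> 'n::finite cmat) \<Rightarrow> (real \<Rightarrow> 'n cmat) \<Rightarrow> (real \<Rightarrow> 'n cmat) \<Rightarrow> real
    \<Rightarrow> (real \<Rightarrow> 'n cmat) \<Rightarrow> bool" where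
  "is_phi P R Z t1 \<phi> \<longleftrightarrow> \<phi> t1 = mat 1 \<and>
    (\<forall>t\<in>{t1..}. (\<phi> has_vector_derivative (P t ** Z t + R t) ** \<phi> t) (at t within {t1..}))"

definition is_psi ::
  "(real \<Rightarrow> 'n::finite cmat) \<Rightarrow> (real \<Rightarrow> 'n cmat) \<Rightarrow> (real \<Rightarrow> 'n cmat) \<Rightarrow> real
    \<Rightarrow> (real \<Rightarrow> 'n cmat) \<Rightarrow> bool" where
  "is_psi P Q Z t1 \<psi> \<longleftrightarrow> \<psi> t1 = mat 1 \<and>
    (\<forall>t\<in>{t1..}. (\<psi> has_vector_derivative \<psi> t ** (Z t ** P t + Q t)) (at t within {t1..}))"

definition riccati_mu ::
  "(real \<Rightarrow> 'n::finite cmat) \<Rightarrow> (real \<Rightarrow> 'n cmat) \<Rightarrow> (real \<Rightarrow> 'n cmat) \<Rightarrow> real \<Rightarrow> real \<Rightarrow> 'n cmat" where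
  "riccati_mu P \<phi> \<psi> t1 t =
    integral {t1..t} (\<lambda>\<tau>. matrix_inv (\<phi> \<tau>) ** P \<tau> ** matrix_inv (\<psi> \<tau>))"

end

theory Submission
  imports Defs
begin

text \<open>For a solution \<open>W\<close> of (E) put \<open>U = \<psi> (W - Z) \<phi>\<close>. The linear terms of (E) cancel and
  \<open>U' = - U \<mu>' U\<close>, so with \<open>C = W(t1) - Z(t1)\<close> one gets \<open>(1 + C \<mu>) U = C\<close>; indeed
  \<open>F = (1 + C \<mu>) U - C\<close> solves the linear equation \<open>F' = - F \<mu>' U\<close> with \<open>F(t1) = 0\<close>. This forces
  \<open>(1 + C \<mu>) (1 - U \<mu>) = 1\<close>, so \<open>1 + C \<mu>\<close> is invertible as long as \<open>W\<close> exists. Conversely, where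
  it is invertible, \<open>Z + \<psi>\<inverse> (1 + C \<mu>)\<inverse> C \<phi>\<inverse>\<close> is a solution. Hence \<open>Z\<close> is normal iff
  \<open>1 + C \<mu>(t)\<close> is invertible for all \<open>t \<ge> t1\<close> and all small \<open>C\<close>. This holds if \<open>\<mu>\<close> is bounded, and
  fails otherwise: a large entry of \<open>\<mu>(t)\<close> yields a small \<open>C\<close> with a single nonzero entry such
  that \<open>1 + C \<mu>(t)\<close> is singular.\<close>

section \<open>Matrix products and transposition as bounded (bi)linear maps\<close>

lemma bounded_bilinear_matrix_matrix_mult:
  "bounded_bilinear ((**) :: complex^'n^'m \<Rightarrow> complex^'k^'n \<Rightarrow> complex^'k^'m)"
  unfolding bilinear_conv_bounded_bilinear[symmetric] bilinear_def linear_iff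
  by (simp add: matrix_matrix_mult_def vec_eq_iff sum.distrib distrib_left distrib_right
      scaleR_sum_right)

lemma bounded_bilinear_matrix_vector_mult:
  "bounded_bilinear ((*v) :: complex^'n^'m \<Rightarrow> complex^'n \<Rightarrow> complex^'m)"
  unfolding bilinear_conv_bounded_bilinear[symmetric] bilinear_def linear_iff
  by (simp add: matrix_vector_mult_def vec_eq_iff sum.distrib distrib_left distrib_right
      scaleR_sum_right)

interpretation mm: bounded_bilinear "(**) :: complex^'n^'m \<Rightarrow> complex^'k^'n \<Rightarrow> complex^'k^'m"
  by (rule bounded_bilinear_matrix_matrix_mult)

interpretation mv: bounded_bilinear "(*v) :: complex^'n^'m \<Rightarrow> complex^'n \<Rightarrow> complex^'m"
  by (rule bounded_bilinear_matrix_vector_mult)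

lemma bounded_linear_transpose:
  "bounded_linear (transpose :: complex^'n^'m \<Rightarrow> complex^'m^'n)"
  unfolding linear_conv_bounded_linear[symmetric] linear_iff
  by (simp add: transpose_def vec_eq_iff)

section \<open>Uniqueness for linear differential equations\<close>

text \<open>A Gronwall estimate for \<open>y \<bullet> y\<close>. The zero \<open>c\<close> may lie
  on either side of \<open>t\<close>: invertibility of fundamental matrices needs the backward
  direction, the Riccati formula the forward one. A general \<open>h\<close> covers matrices acting
  on vectors and on matrices from the right.\<close>

lemma linear_ode_zero:
  fixes h :: "'a::real_normed_vector \<Rightarrow> 'b::real_inner \<Rightarrow> 'b" and y :: "real \<Rightarrow> 'b"
  assumes h: "bounded_bilinear h"
    and A: "continuous_on {a..b} A"
    and y: "\<And>t. t \<in> {a..b} \<Longrightarrow> (y has_vector_derivative h (A t) (y t)) (at t within {a..b})"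
    and c: "c \<in> {a..b}" "y c = 0" and t: "t \<in> {a..b}"
  shows "y t = 0"
proof -
  obtain B where B: "\<And>t. t \<in> {a..b} \<Longrightarrow> norm (A t) \<le> B"
    using compact_imp_bounded[OF compact_continuous_image[OF A compact_Icc]]
    by (auto simp: bounded_iff simp del: atLeastAtMost_iff)
  obtain K where K: "K > 0" "\<And>u v. norm (h u v) \<le> norm u * norm v * K"
    using bounded_bilinear.pos_bounded[OF h] by blast
  define L where "L = 2 * (B * K)"
  define N' where "N' t = 2 * (y t \<bullet> h (A t) (y t))" for t
  have N': "\<bar>N' t\<bar> \<le> L * (y t \<bullet> y t)" if "t \<in> {a..b}" for t
  proof -
    have "\<bar>y t \<bullet> h (A t) (y t)\<bar> \<le> norm (y t) * norm (h (A t) (y t))"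
      by (rule Cauchy_Schwarz_ineq2)
    also have "\<dots> \<le> norm (y t) * (B * norm (y t) * K)"
      using B[OF that] K
      by (intro mult_left_mono order_trans[OF K(2)] mult_right_mono) auto
    finally show ?thesis
      by (simp add: N'_def L_def power2_norm_eq_inner[symmetric] power2_eq_square algebra_simps)
  qed
  \<comment> \<open>Integrating factor: by the bound on \<open>N'\<close>, \<open>g (-L)\<close> is
    decreasing and \<open>g L\<close> increasing. The former is used to the right of
    \<open>c\<close>, the latter to the left.\<close>
  define g where "g s t = (y t \<bullet> y t) * exp (s * t)" for s t
  have dg: "(g s has_real_derivative (N' t + s * (y t \<bullet> y t)) * exp (s * t)) (at t within {a..b})"
    if "t \<in> {a..b}" for s t
  proof -
    have "((\<lambda>t. y t \<bullet> y t) has_real_derivative N' t) (at t within {a..b})"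
      using bounded_bilinear.has_vector_derivative[OF bounded_bilinear_inner y[OF that] y[OF that]]
      by (simp add: has_real_derivative_iff_has_vector_derivative N'_def inner_commute)
    note [derivative_intros] = this
    show ?thesis
      unfolding g_def by (auto intro!: derivative_eq_intros simp: algebra_simps)
  qed
  have cont: "continuous_on {u..v} (g s)" if "{u..v} \<subseteq> {a..b}" for s u v
    using dg that by (meson DERIV_continuous continuous_on_eq_continuous_within continuous_on_subset)
  have deriv: "(g s has_real_derivative (N' t + s * (y t \<bullet> y t)) * exp (s * t)) (at t)"
    if "a < t" "t < b" for s t
    using dg[of t s] that by (simp add: at_within_Icc_at)
  have "y t \<bullet> y t \<le> 0"
  proof (cases "c \<le> t")
    case True
    have "g (-L) c \<ge> g (-L) t"
    proof (rule DERIV_nonpos_imp_decreasing_open[OF True])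
      fix x assume x: "c < x" "x < t"
      then have "N' x + (-L) * (y x \<bullet> y x) \<le> 0"
        using N'[of x] c t by auto
      then show "\<exists>d. (g (-L) has_real_derivative d) (at x) \<and> d \<le> 0"
        using deriv[of x "-L"] x c t by (auto intro!: exI mult_nonpos_nonneg)
    qed (use cont c t in auto)
    then show ?thesis
      using c by (simp add: g_def mult_le_0_iff not_le[symmetric])
  next
    case False
    have "g L t \<le> g L c"
    proof (rule DERIV_nonneg_imp_increasing_open[of t c])
      fix x assume x: "t < x" "x < c"
      then have "N' x + L * (y x \<bullet> y x) \<ge> 0"
        using N'[of x] c t by auto
      then show "\<exists>d. (g L has_real_derivative d) (at x) \<and> d \<ge> 0"
        using deriv[of x L] x c t by (auto intro!: exI mult_nonneg_nonneg)
    qed (use cont c t False in auto)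
    then show ?thesis
      using c by (simp add: g_def mult_le_0_iff not_le[symmetric])
  qed
  then show ?thesis
    using inner_ge_zero[of "y t"] inner_eq_zero_iff[of "y t"] by linarith
qed

section \<open>Inverse matrices: perturbation, continuity, derivative\<close>

lemma invertible_if_no_kernel:
  fixes A :: "complex^'n^'n"
  assumes "\<And>v. A *v v = 0 \<Longrightarrow> v = 0"
  shows "invertible A"
proof -
  have "inj ((*v) A)"
    using assms by (metis (no_types) injI matrix_vector_mult_diff_distrib right_minus_eq)
  then show ?thesis
    by (simp add: invertible_left_inverse matrix_left_invertible_injective)
qed

lemma matrix_inv_cancel:
  fixes A :: "complex^'n^'n"
  assumes "invertible A"
  shows "A ** matrix_inv A = mat 1" "matrix_inv A ** A = mat 1"
    "X ** A ** matrix_inv A = X" "X ** matrix_inv A ** A = X"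
proof -
  have "A ** matrix_inv A = mat 1 \<and> matrix_inv A ** A = mat 1"
    using assms unfolding invertible_def matrix_inv_def by (rule someI_ex)
  then show "A ** matrix_inv A = mat 1" "matrix_inv A ** A = mat 1"
    "X ** A ** matrix_inv A = X" "X ** matrix_inv A ** A = X"
    by (simp_all add: matrix_mul_assoc[symmetric])
qed

text \<open>A kernel vector satisfies \<open>v = - (A *v v)\<close>, which is impossible for
  \<open>v \<noteq> 0\<close> once \<open>A\<close> contracts norms. The constant \<open>K\<close>
  of the bilinear map enters because the norm of \<open>A\<close> is the Euclidean norm of its
  entries, not the operator norm.\<close>

lemma invertible_mat_1_plus:
  obtains \<epsilon> where "\<epsilon> > 0" "\<And>A :: complex^'n^'n. norm A < \<epsilon> \<Longrightarrow> invertible (mat 1 + A)"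
proof -
  obtain K where K: "K > 0" "\<And>(A :: complex^'n^'n) v. norm (A *v v) \<le> norm A * norm v * K"
    using mv.pos_bounded by blast
  have "invertible (mat 1 + A)" if "norm A < 1 / K" for A :: "complex^'n^'n"
  proof (rule invertible_if_no_kernel, rule ccontr)
    fix v assume "(mat 1 + A) *v v = 0" "v \<noteq> 0"
    then have "norm v = norm (A *v v)"
      by (simp add: matrix_vector_mult_add_rdistrib add_eq_0_iff)
    also have "\<dots> \<le> (norm A * K) * norm v"
      using K(2)[of A v] by (simp add: ac_simps)
    also have "\<dots> < 1 * norm v"
      using that K(1) \<open>v \<noteq> 0\<close> by (intro mult_strict_right_mono) (auto simp: field_simps)
    finally show False by simp
  qed
  then show thesis using that[of "1 / K"] K(1) by simp
qed

text \<open>The resolvent identity, from which both continuity and the derivative of the inverse are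
  derived.\<close>

lemma matrix_inv_diff:
  fixes A B :: "complex^'n^'n"
  assumes "invertible A" "invertible B"
  shows "matrix_inv A - matrix_inv B = - (matrix_inv A ** (A - B) ** matrix_inv B)"
  using assms by (simp add: mm.diff_left mm.diff_right matrix_inv_cancel)

lemma tendsto_matrix_inv:
  fixes G :: "'a \<Rightarrow> complex^'n^'n"
  assumes G: "(G \<longlongrightarrow> L) F" and inv: "eventually (\<lambda>x. invertible (G x)) F" and L: "invertible L"
  shows "((\<lambda>x. matrix_inv (G x)) \<longlongrightarrow> matrix_inv L) F"
proof -
  obtain K where K: "K > 0" "\<And>(A :: complex^'n^'n) (B :: complex^'n^'n). norm (A ** B) \<le> norm A * norm B * K"
    using mm.pos_bounded by blast
  define l where "l = norm (matrix_inv L)"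
  define d where "d x = norm (G x - L)" for x
  have bound: "norm (matrix_inv (G x) - matrix_inv L) \<le> norm (matrix_inv (G x)) * (d x * l * K * K)"
    if "invertible (G x)" for x
  proof -
    have "norm (matrix_inv (G x) - matrix_inv L)
        \<le> norm (matrix_inv (G x) ** (G x - L)) * norm (matrix_inv L) * K"
      unfolding matrix_inv_diff[OF that L] norm_minus_cancel by (rule K)
    also have "\<dots> \<le> (norm (matrix_inv (G x)) * norm (G x - L) * K) * norm (matrix_inv L) * K"
      using K by (intro mult_right_mono) auto
    finally show ?thesis by (simp add: l_def d_def ac_simps)
  qed
  have d: "(d \<longlongrightarrow> 0) F"
    unfolding d_def by (rule tendsto_norm_zero) (use G in \<open>simp add: LIM_zero_iff\<close>)
  have dl: "((\<lambda>x. d x * l * K * K) \<longlongrightarrow> 0) F"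
    using tendsto_mult_left_zero[OF d, of "l * K * K"] by (simp add: mult.assoc)
  \<comment> \<open>The estimate \<open>bound\<close> still contains the unknown norm of
    \<open>matrix_inv (G x)\<close>. Once its other factor is below 1/2, the triangle inequality
    absorbs this norm and bounds it by \<open>2 * l\<close>.\<close>
  have "eventually (\<lambda>x. d x * l * K * K < 1 / 2) F"
    using dl by (rule order_tendstoD) simp
  then have "eventually (\<lambda>x. norm (matrix_inv (G x) - matrix_inv L) \<le> 2 * l * (d x * l * K * K)) F"
    using inv
  proof eventually_elim
    case (elim x)
    let ?e = "d x * l * K * K"
    have e: "0 \<le> ?e" using K by (simp add: d_def l_def)
    have "norm (matrix_inv (G x)) \<le> l + norm (matrix_inv (G x) - matrix_inv L)"
      unfolding l_def using norm_triangle_sub by blast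
    also have "\<dots> \<le> l + norm (matrix_inv (G x)) * (1/2)"
      using bound[OF elim(2)] elim(1) mult_left_mono[of ?e "1/2" "norm (matrix_inv (G x))"] by simp
    finally have "norm (matrix_inv (G x)) \<le> 2 * l" by simp
    from mult_right_mono[OF this e] bound[OF elim(2)] show ?case by linarith
  qed
  then have "((\<lambda>x. matrix_inv (G x) - matrix_inv L) \<longlongrightarrow> 0) F"
    by (rule Lim_null_comparison) (use tendsto_mult_right_zero[OF dl] in auto)
  then show ?thesis by (simp add: LIM_zero_iff)
qed

lemma has_vector_derivative_iff_tendsto:
  fixes f :: "real \<Rightarrow> 'a::real_normed_vector"
  shows "(f has_vector_derivative D) (at x within S) \<longleftrightarrow>
    ((\<lambda>y. (f y - f x) /\<^sub>R (y - x)) \<longlongrightarrow> D) (at x within S)"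
proof -
  have "norm (f y - f x - (y - x) *\<^sub>R D) / norm (y - x) = norm ((f y - f x) /\<^sub>R (y - x) - D)"
    if "y \<noteq> x" for y
  proof -
    have "(f y - f x) /\<^sub>R (y - x) - D = (f y - f x - (y - x) *\<^sub>R D) /\<^sub>R (y - x)"
      using that by (simp add: scaleR_diff_right)
    then show ?thesis by (simp add: divide_inverse)
  qed
  then have "((\<lambda>y. norm (f y - f x - (y - x) *\<^sub>R D) / norm (y - x)) \<longlongrightarrow> 0) (at x within S) \<longleftrightarrow>
      ((\<lambda>y. norm ((f y - f x) /\<^sub>R (y - x) - D)) \<longlongrightarrow> 0) (at x within S)"
    by (intro tendsto_cong) (simp add: eventually_at_filter)
  then show ?thesis
    by (simp add: has_vector_derivative_def has_derivative_iff_norm bounded_linear_scaleR_left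
        tendsto_norm_zero_iff LIM_zero_iff)
qed

text \<open>By the resolvent identity the difference quotient of the inverse is that of
  \<open>G\<close> between two inverses, up to sign; continuity of the inverse then gives the
  limit.\<close>

lemma has_vector_derivative_matrix_inv:
  fixes G :: "real \<Rightarrow> complex^'n^'n"
  assumes G: "(G has_vector_derivative G') (at t within J)"
    and inv: "\<And>s. s \<in> J \<Longrightarrow> invertible (G s)" and t: "t \<in> J"
  shows "((\<lambda>s. matrix_inv (G s)) has_vector_derivative
    - (matrix_inv (G t) ** G' ** matrix_inv (G t))) (at t within J)"
proof -
  have "((\<lambda>s. matrix_inv (G s)) \<longlongrightarrow> matrix_inv (G t)) (at t within J)"
    using has_vector_derivative_continuous[OF G] inv t
    by (intro tendsto_matrix_inv) (auto simp: continuous_within eventually_at_filter)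
  then have "((\<lambda>s. - (matrix_inv (G s) ** ((G s - G t) /\<^sub>R (s - t)) ** matrix_inv (G t)))
      \<longlongrightarrow> - (matrix_inv (G t) ** G' ** matrix_inv (G t))) (at t within J)"
    using G unfolding has_vector_derivative_iff_tendsto
    by (intro tendsto_minus mm.tendsto tendsto_const)
  moreover have "eventually (\<lambda>s. - (matrix_inv (G s) ** ((G s - G t) /\<^sub>R (s - t)) ** matrix_inv (G t))
      = (matrix_inv (G s) - matrix_inv (G t)) /\<^sub>R (s - t)) (at t within J)"
    using inv t by (auto simp: eventually_at_filter matrix_inv_diff mm.scaleR_left mm.scaleR_right)
  ultimately show ?thesis
    unfolding has_vector_derivative_iff_tendsto by (rule Lim_transform_eventually)
qed

section \<open>Invertibility of fundamental matrices\<close>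

text \<open>If \<open>\<Phi> t\<close> annihilates \<open>v\<close>, then
  \<open>\<Phi> s *v v\<close> solves a linear equation and vanishes at \<open>t\<close>, hence also
  at \<open>a\<close>, where it equals \<open>v\<close>.\<close>

lemma fundamental_matrix_invertible:
  fixes \<Phi> :: "real \<Rightarrow> complex^'n^'n"
  assumes A: "continuous_on {a..} A" and init: "\<Phi> a = mat 1"
    and \<Phi>: "\<And>t. t \<in> {a..} \<Longrightarrow> (\<Phi> has_vector_derivative A t ** \<Phi> t) (at t within {a..})"
    and t: "t \<in> {a..}"
  shows "invertible (\<Phi> t)"
proof (rule invertible_if_no_kernel)
  fix v assume v: "\<Phi> t *v v = 0"
  have "\<Phi> a *v v = 0"
  proof (rule linear_ode_zero[OF bounded_bilinear_matrix_vector_mult, of a t A "\<lambda>s. \<Phi> s *v v" t])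
    show "continuous_on {a..t} A"
      using A by (rule continuous_on_subset) auto
    fix s assume s: "s \<in> {a..t}"
    then have "(\<Phi> has_vector_derivative A s ** \<Phi> s) (at s within {a..t})"
      by (intro has_vector_derivative_within_subset[OF \<Phi>]) auto
    from mv.has_vector_derivative[OF this has_vector_derivative_const[of v]]
    show "((\<lambda>s. \<Phi> s *v v) has_vector_derivative A s *v (\<Phi> s *v v)) (at s within {a..t})"
      by (simp add: matrix_vector_mul_assoc)
  qed (use t v in auto)
  then show "v = 0" by (simp add: init)
qed

text \<open>Transposition moves the coefficient to the left and reduces this to the previous
  case.\<close>

lemma adjoint_fundamental_matrix_invertible:
  fixes \<Psi> :: "real \<Rightarrow> complex^'n^'n"
  assumes A: "continuous_on {a..} A" and init: "\<Psi> a = mat 1"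
    and \<Psi>: "\<And>t. t \<in> {a..} \<Longrightarrow> (\<Psi> has_vector_derivative \<Psi> t ** A t) (at t within {a..})"
    and t: "t \<in> {a..}"
  shows "invertible (\<Psi> t)"
proof -
  have "invertible (transpose (\<Psi> t))"
  proof (rule fundamental_matrix_invertible[where A = "\<lambda>t. transpose (A t)"])
    show "continuous_on {a..} (\<lambda>t. transpose (A t))"
      using A by (rule bounded_linear.continuous_on[OF bounded_linear_transpose])
    show "((\<lambda>t. transpose (\<Psi> t)) has_vector_derivative transpose (A t) ** transpose (\<Psi> t))
        (at t within {a..})" if "t \<in> {a..}" for t
      using bounded_linear.has_vector_derivative[OF bounded_linear_transpose \<Psi>[OF that]]
      by (simp add: matrix_transpose_mul)
  qed (use t in \<open>simp_all add: init\<close>)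
  then show ?thesis
    using invertible_left_inverse invertible_right_inverse left_invertible_transpose by blast
qed

section \<open>Entrywise bounds and small singular perturbations\<close>

lemma matrix_entry_le_imp_norm_le:
  fixes A :: "complex^'n^'m"
  assumes "\<And>i j. norm (A $ i $ j) \<le> B"
  shows "norm A \<le> of_nat CARD('m) * (of_nat CARD('n) * B)"
proof -
  have row: "norm (A $ i) \<le> of_nat CARD('n) * B" for i
  proof -
    have "norm (A $ i) \<le> (\<Sum>j\<in>UNIV. norm (A $ i $ j))"
      unfolding norm_vec_def by (rule L2_set_le_sum) simp
    also have "\<dots> \<le> of_nat CARD('n) * B"
      using assms by (intro sum_bounded_above)
    finally show ?thesis .
  qed
  have "norm A \<le> (\<Sum>i\<in>UNIV. norm (A $ i))"
    unfolding norm_vec_def by (rule L2_set_le_sum) simp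
  also have "\<dots> \<le> of_nat CARD('m) * (of_nat CARD('n) * B)"
    using row by (intro sum_bounded_above)
  finally show ?thesis .
qed

text \<open>The matrix \<open>C\<close> is a multiple of a matrix unit, scaled so that \<open>C ** M\<close> has eigenvalue \<open>-1\<close>.\<close>

lemma singular_perturbation:
  fixes M :: "complex^'n^'n"
  assumes "M $ i $ j \<noteq> 0"
  obtains C :: "complex^'n^'n"
    where "norm C \<le> of_nat CARD('n) * (of_nat CARD('n) / norm (M $ i $ j))"
    "\<not> invertible (mat 1 + C ** M)"
proof -
  define C :: "complex^'n^'n" where
    "C = (\<chi> k l. if k = j \<and> l = i then - (1 / M $ i $ j) else 0)"
  have "norm C \<le> of_nat CARD('n) * (of_nat CARD('n) * (1 / norm (M $ i $ j)))"
    by (rule matrix_entry_le_imp_norm_le) (simp add: C_def norm_divide)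
  moreover have "\<not> invertible (mat 1 + C ** M)"
  proof
    assume "invertible (mat 1 + C ** M)"
    then obtain D where D: "D ** (mat 1 + C ** M) = mat 1"
      by (auto simp: invertible_def)
    \<comment> \<open>Column \<open>j\<close> of \<open>C ** M\<close> is minus the unit vector, so
      \<open>axis j 1\<close> lies in the kernel of \<open>mat 1 + C ** M\<close>.\<close>
    have "(C ** M) $ k $ j = (if k = j then - 1 else 0)" for k
    proof -
      have "(C ** M) $ k $ j = (\<Sum>l\<in>UNIV. if l = i then (if k = j then - 1 else 0) else 0)"
        unfolding matrix_matrix_mult_def vec_lambda_beta
        by (rule sum.cong) (use assms in \<open>auto simp: C_def\<close>)
      then show ?thesis by simp
    qed
    then have "(C ** M) *v axis j 1 = - axis j 1"
      by (simp add: vec_eq_iff matrix_vector_mult_def axis_def if_distrib cong: if_cong)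
    then have "(mat 1 + C ** M) *v axis j 1 = 0"
      by (simp add: matrix_vector_mult_add_rdistrib)
    then have "D ** (mat 1 + C ** M) *v axis j 1 = 0"
      by (simp add: matrix_vector_mul_assoc[symmetric])
    then show False
      by (simp add: D axis_eq_0_iff)
  qed
  ultimately show thesis using that by simp
qed

section \<open>Linearization of the Riccati equation around \<open>Z\<close>\<close>

lemma riccati_solution_on_deriv:
  assumes "riccati_solution_on P Q R S J W" "t \<in> J"
  shows "(W has_vector_derivative - (W t ** P t ** W t + Q t ** W t + W t ** R t + S t)) (at t within J)"
proof -
  obtain W' where W': "(W has_vector_derivative W') (at t within J)"
    "W' + W t ** P t ** W t + Q t ** W t + W t ** R t + S t = 0"
    using assms unfolding riccati_solution_on_def by blast
  from W'(2) have "W' = - (W t ** P t ** W t + Q t ** W t + W t ** R t + S t)"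
    by (simp only: eq_neg_iff_add_eq_0 add.assoc)
  with W'(1) show ?thesis by simp
qed

locale riccati_linearization =
  fixes P Q R S Z \<phi> \<psi> :: "real \<Rightarrow> complex^'n^'n" and t1 :: real
  assumes P: "continuous_on {t1..} P"
    and Q: "continuous_on {t1..} Q"
    and R: "continuous_on {t1..} R"
    and Z: "regular_solution P Q R S t1 Z"
    and \<phi>: "is_phi P R Z t1 \<phi>"
    and \<psi>: "is_psi P Q Z t1 \<psi>"
begin

text \<open>The integrand of \<open>\<mu>\<close>, and the only coefficient left in the transformed
  equation \<open>U' = - U M U\<close>.\<close>

definition M where "M t = matrix_inv (\<phi> t) ** P t ** matrix_inv (\<psi> t)"

abbreviation \<mu> where "\<mu> \<equiv> riccati_mu P \<phi> \<psi> t1"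

lemma \<phi>_deriv: "(\<phi> has_vector_derivative (P t ** Z t + R t) ** \<phi> t) (at t within {t1..})"
  and \<psi>_deriv: "(\<psi> has_vector_derivative \<psi> t ** (Z t ** P t + Q t)) (at t within {t1..})"
  if "t \<in> {t1..}"
  using \<phi> \<psi> that by (auto simp: is_phi_def is_psi_def)

lemma init: "\<phi> t1 = mat 1" "\<psi> t1 = mat 1"
  using \<phi> \<psi> by (auto simp: is_phi_def is_psi_def)

lemma Z_deriv:
  assumes "t \<in> {t1..}"
  shows "(Z has_vector_derivative - (Z t ** P t ** Z t + Q t ** Z t + Z t ** R t + S t))
    (at t within {t1..})"
  using Z assms unfolding regular_solution_def by (rule riccati_solution_on_deriv)

lemma Z_continuous: "continuous_on {t1..} Z"
  using Z_deriv by (rule continuous_on_vector_derivative)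

lemma invertible_\<phi>: "t \<in> {t1..} \<Longrightarrow> invertible (\<phi> t)"
  by (rule fundamental_matrix_invertible[OF _ init(1) \<phi>_deriv])
    (intro continuous_intros mm.continuous_on P R Z_continuous)

lemma invertible_\<psi>: "t \<in> {t1..} \<Longrightarrow> invertible (\<psi> t)"
  by (rule adjoint_fundamental_matrix_invertible[OF _ init(2) \<psi>_deriv])
    (intro continuous_intros mm.continuous_on P Q Z_continuous)

lemma M_continuous: "continuous_on {t1..} M"
  unfolding M_def
proof (intro mm.continuous_on P)
  show "continuous_on {t1..} (\<lambda>t. matrix_inv (\<phi> t))"
    by (rule continuous_on_vector_derivative, rule has_vector_derivative_matrix_inv[OF \<phi>_deriv])
      (use invertible_\<phi> in auto)
  show "continuous_on {t1..} (\<lambda>t. matrix_inv (\<psi> t))"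
    by (rule continuous_on_vector_derivative, rule has_vector_derivative_matrix_inv[OF \<psi>_deriv])
      (use invertible_\<psi> in auto)
qed

lemma \<mu>_init: "\<mu> t1 = 0"
  by (simp add: riccati_mu_def)

lemma \<mu>_deriv:
  assumes "t \<in> {t1..}"
  shows "(\<mu> has_vector_derivative M t) (at t within {t1..})"
proof -
  \<comment> \<open>A compact interval reaching beyond \<open>t\<close> has the same one-sided or
    two-sided neighborhoods of \<open>t\<close> as the half-line.\<close>
  have "continuous_on {t1..t + 1} M"
    using M_continuous by (rule continuous_on_subset) auto
  then have "((\<lambda>u. integral {t1..u} M) has_vector_derivative M t) (at t within {t1..t + 1})"
    using assms by (intro integral_has_vector_derivative) auto
  moreover have "at t within {t1..t + 1} = at t within {t1..}"
    using assms by (intro at_within_nhd[of t "{..<t + 1}"]) auto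
  ultimately show ?thesis
    by (simp add: riccati_mu_def[abs_def] M_def[abs_def])
qed

lemma P_eq: "t \<in> {t1..} \<Longrightarrow> P t = \<phi> t ** M t ** \<psi> t"
  by (simp add: M_def matrix_mul_assoc matrix_inv_cancel invertible_\<phi> invertible_\<psi>)

text \<open>With \<open>D = W - Z\<close>, subtracting the two equations gives
  \<open>D' = - D P D - (Z P + Q) D - D (P Z + R)\<close>. The derivatives of \<open>\<psi>\<close>
  and \<open>\<phi>\<close> cancel the two linear terms, and \<open>P = \<phi> M \<psi>\<close> puts
  the quadratic one into the stated form.\<close>

lemma transformed_deriv:
  assumes W: "riccati_solution_on P Q R S J W" and J: "J \<subseteq> {t1..}" and t: "t \<in> J"
  shows "((\<lambda>t. \<psi> t ** (W t - Z t) ** \<phi> t) has_vector_derivative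
    - ((\<psi> t ** (W t - Z t) ** \<phi> t) ** M t ** (\<psi> t ** (W t - Z t) ** \<phi> t))) (at t within J)"
proof -
  have t': "t \<in> {t1..}" using J t by auto
  note sub = has_vector_derivative_within_subset[OF _ J]
  have Wd: "(W has_vector_derivative - (W t ** P t ** W t + Q t ** W t + W t ** R t + S t)) (at t within J)"
    using W t by (rule riccati_solution_on_deriv)
  have "(\<psi> t ** (W t - Z t) ** \<phi> t) ** M t ** (\<psi> t ** (W t - Z t) ** \<phi> t)
      = \<psi> t ** (W t - Z t) ** (\<phi> t ** M t ** \<psi> t) ** (W t - Z t) ** \<phi> t"
    by (simp add: matrix_mul_assoc)
  also have "\<dots> = \<psi> t ** (W t - Z t) ** P t ** (W t - Z t) ** \<phi> t"
    by (simp add: P_eq[OF t'])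
  finally have eq: "(\<psi> t ** (W t - Z t) ** \<phi> t) ** M t ** (\<psi> t ** (W t - Z t) ** \<phi> t)
    = \<psi> t ** (W t - Z t) ** P t ** (W t - Z t) ** \<phi> t" .
  show ?thesis
    unfolding eq
    by (rule has_vector_derivative_eq_rhs[OF mm.has_vector_derivative[OF mm.has_vector_derivative[OF
       sub[OF \<psi>_deriv[OF t']] has_vector_derivative_diff[OF Wd sub[OF Z_deriv[OF t']]]] sub[OF \<phi>_deriv[OF t']]]])
      (simp add: mm.add_left mm.add_right mm.diff_left mm.diff_right mm.minus_left mm.minus_right
        matrix_mul_assoc)
qed

text \<open>For invertible \<open>U\<close> the equation \<open>U' = - U M U\<close> says that the
  inverse of \<open>U\<close> has derivative \<open>M\<close>. Multiplying the integrated relation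
  by \<open>C\<close> removes both inverses, and in this form it holds for singular \<open>C\<close>
  as well.\<close>

lemma transformed_implicit:
  assumes W: "riccati_solution_on P Q R S J W" and J: "{t1..t} \<subseteq> J" and t: "t1 \<le> t"
  shows "(mat 1 + (W t1 - Z t1) ** \<mu> t) ** (\<psi> t ** (W t - Z t) ** \<phi> t) = W t1 - Z t1"
proof -
  define C where "C = W t1 - Z t1"
  define U where "U t = \<psi> t ** (W t - Z t) ** \<phi> t" for t
  define F where "F t = (mat 1 + C ** \<mu> t) ** U t - C" for t
  have W': "riccati_solution_on P Q R S {t1..t} W"
    using W J unfolding riccati_solution_on_def
    by (meson has_vector_derivative_within_subset subsetD)
  have Ud: "(U has_vector_derivative - (U s ** M s ** U s)) (at s within {t1..t})" if "s \<in> {t1..t}" for s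
    using transformed_deriv[OF W' _ that] unfolding U_def by auto
  have Uc: "continuous_on {t1..t} U"
    using Ud by (rule continuous_on_vector_derivative)
  have "F t = 0"
  \<comment> \<open>The product is flipped because the coefficient \<open>- (M s ** U s)\<close>
    multiplies \<open>F s\<close> from the right. As \<open>U\<close> is a known function here, the
    equation is linear in \<open>F\<close>.\<close>
  proof (rule linear_ode_zero[OF bounded_bilinear.flip[OF bounded_bilinear_matrix_matrix_mult],
        of t1 t "\<lambda>s. - (M s ** U s)" F t1])
    show "continuous_on {t1..t} (\<lambda>s. - (M s ** U s))"
      by (intro continuous_intros mm.continuous_on Uc continuous_on_subset[OF M_continuous]) auto
    fix s assume s: "s \<in> {t1..t}"
    have "(\<mu> has_vector_derivative M s) (at s within {t1..t})"
      by (rule has_vector_derivative_within_subset[OF \<mu>_deriv]) (use s in auto)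
    from mm.has_vector_derivative[OF has_vector_derivative_add[OF has_vector_derivative_const[of "mat 1"]
        mm.has_vector_derivative[OF has_vector_derivative_const[of C] this]] Ud[OF s]]
    have "((\<lambda>s. (mat 1 + C ** \<mu> s) ** U s) has_vector_derivative
        (mat 1 + C ** \<mu> s) ** - (U s ** M s ** U s) + (0 + (C ** M s + 0 ** \<mu> s)) ** U s) (at s within {t1..t})" .
    from has_vector_derivative_diff[OF this has_vector_derivative_const[of C]]
    show "(F has_vector_derivative F s ** - (M s ** U s)) (at s within {t1..t})"
      unfolding F_def
      by (rule has_vector_derivative_eq_rhs) (simp add: mm.add_left mm.add_right mm.diff_left
        mm.diff_right mm.minus_left mm.minus_right matrix_mul_assoc)
  qed (use t in \<open>auto simp: F_def U_def C_def \<mu>_init init\<close>)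
  then show ?thesis by (simp add: F_def U_def C_def)
qed

text \<open>The right inverse is \<open>mat 1 - U ** \<mu> t\<close>, because
  \<open>(1 + C \<mu>) U = C\<close> cancels the remaining terms; for square matrices one side
  suffices.\<close>

lemma invertible_along_solution:
  assumes W: "riccati_solution_on P Q R S J W" and J: "{t1..t} \<subseteq> J" and t: "t1 \<le> t"
  shows "invertible (mat 1 + (W t1 - Z t1) ** \<mu> t)"
proof -
  let ?C = "W t1 - Z t1" and ?U = "\<psi> t ** (W t - Z t) ** \<phi> t"
  have "(mat 1 + ?C ** \<mu> t) ** (mat 1 - ?U ** \<mu> t) = mat 1 + ?C ** \<mu> t - ((mat 1 + ?C ** \<mu> t) ** ?U) ** \<mu> t"
    unfolding mm.diff_right by (simp add: matrix_mul_assoc)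
  also have "\<dots> = mat 1"
    by (simp add: transformed_implicit[OF assms])
  finally show ?thesis
    using invertible_right_inverse by blast
qed

text \<open>The implicit relation determines \<open>U\<close> from the common initial value, since
  its factor is invertible along \<open>W\<close>; undoing the invertible \<open>\<psi>\<close> and
  \<open>\<phi>\<close> recovers the solution itself.\<close>

lemma solution_unique:
  assumes V: "riccati_solution_on P Q R S J V" "{t1..t} \<subseteq> J"
    and W: "riccati_solution_on P Q R S J' W" "{t1..t} \<subseteq> J'"
    and t: "t1 \<le> t" and eq: "V t1 = W t1"
  shows "V t = W t"
proof -
  let ?G = "mat 1 + (W t1 - Z t1) ** \<mu> t"
  obtain G' where "G' ** ?G = mat 1"
    using invertible_along_solution[OF W t] by (auto simp: invertible_def)
  moreover have "?G ** (\<psi> t ** (V t - Z t) ** \<phi> t) = ?G ** (\<psi> t ** (W t - Z t) ** \<phi> t)"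
    using transformed_implicit[OF V t] transformed_implicit[OF W t] eq by simp
  ultimately have "\<psi> t ** (V t - Z t) ** \<phi> t = \<psi> t ** (W t - Z t) ** \<phi> t"
    by (metis matrix_mul_assoc matrix_mul_lid)
  then have "matrix_inv (\<psi> t) ** (\<psi> t ** (V t - Z t) ** \<phi> t) ** matrix_inv (\<phi> t)
      = matrix_inv (\<psi> t) ** (\<psi> t ** (W t - Z t) ** \<phi> t) ** matrix_inv (\<phi> t)"
    by simp
  then have "V t - Z t = W t - Z t"
    using t by (simp add: matrix_mul_assoc matrix_inv_cancel invertible_\<phi> invertible_\<psi>)
  then show ?thesis by simp
qed

text \<open>An explicit solution, with \<open>J\<close> left free so that it serves both a short
  interval and the whole half-line.\<close>

lemma solution_exists:
  assumes J: "J \<subseteq> {t1..}" and inv: "\<And>t. t \<in> J \<Longrightarrow> invertible (mat 1 + C ** \<mu> t)"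
  obtains W where "riccati_solution_on P Q R S J W" "W t1 = Z t1 + C"
proof -
  define G where "G t = mat 1 + C ** \<mu> t" for t
  define H where "H t = matrix_inv (G t)" for t
  define f where "f t = matrix_inv (\<phi> t)" for t
  define p where "p t = matrix_inv (\<psi> t)" for t
  \<comment> \<open>Obtained by solving \<open>(1 + C \<mu>) U = C\<close> for \<open>U\<close> and
    reversing the substitution \<open>U = \<psi> (W - Z) \<phi>\<close>.\<close>
  define W where "W t = Z t + p t ** (H t ** C) ** f t" for t
  have init_W: "W t1 = Z t1 + C"
    using matrix_inv_cancel(1)[of "mat 1 :: complex^'n^'n"]
    by (simp add: W_def f_def p_def H_def G_def init \<mu>_init invertible_def)
  have "riccati_solution_on P Q R S J W"
    unfolding riccati_solution_on_def
  proof (intro ballI exI conjI)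
    fix t assume t: "t \<in> J"
    then have t': "t \<in> {t1..}" using J by auto
    note sub = has_vector_derivative_within_subset[OF _ J]
    have invs: "invertible (\<phi> t)" "invertible (\<psi> t)" "invertible (G t)"
      using invertible_\<phi> invertible_\<psi> inv t t' by (auto simp: G_def)
    have Gd: "(G has_vector_derivative C ** M t) (at t within J)"
      using has_vector_derivative_add[OF has_vector_derivative_const[of "mat 1"]
        mm.has_vector_derivative[OF has_vector_derivative_const[of C] sub[OF \<mu>_deriv[OF t']]]]
      by (simp add: G_def[abs_def])
    have Hd: "(H has_vector_derivative - (H t ** (C ** M t) ** H t)) (at t within J)"
      unfolding H_def by (rule has_vector_derivative_matrix_inv[OF Gd _ t]) (simp add: G_def inv)
    have fd: "(f has_vector_derivative - (f t ** (P t ** Z t + R t))) (at t within J)"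
      using has_vector_derivative_matrix_inv[OF sub[OF \<phi>_deriv[OF t']] _ t] invertible_\<phi> J invs
      by (auto simp: f_def[abs_def] matrix_mul_assoc matrix_inv_cancel)
    have pd: "(p has_vector_derivative - ((Z t ** P t + Q t) ** p t)) (at t within J)"
      using has_vector_derivative_matrix_inv[OF sub[OF \<psi>_deriv[OF t']] _ t] invertible_\<psi> J invs
      by (auto simp: p_def[abs_def] matrix_mul_assoc matrix_inv_cancel)
    have "p t ** (H t ** (C ** M t) ** H t ** C) ** f t = p t ** (H t ** C) ** f t ** P t ** (p t ** (H t ** C) ** f t)"
      by (simp add: M_def f_def p_def matrix_mul_assoc)
    note eq = this[unfolded matrix_mul_assoc]
    show "(W has_vector_derivative - (W t ** P t ** W t + Q t ** W t + W t ** R t + S t)) (at t within J)"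
      unfolding W_def[abs_def]
      by (rule has_vector_derivative_eq_rhs[OF has_vector_derivative_add[OF sub[OF Z_deriv[OF t']]
        mm.has_vector_derivative[OF mm.has_vector_derivative[OF pd
          mm.has_vector_derivative[OF Hd has_vector_derivative_const[of C]]] fd]]])
       (simp add: mm.add_left mm.add_right mm.diff_left mm.diff_right mm.minus_left mm.minus_right
         matrix_mul_assoc eq)
  qed simp
  then show thesis using init_W by (rule that)
qed

section \<open>Normality and boundedness of \<open>\<mu>\<close>\<close>

lemma normal_if_bounded:
  assumes "bounded (\<mu> ` {t1..})"
  shows "normal_solution P Q R S t1 Z"
proof -
  obtain B where B: "B > 0" "\<And>t. t \<in> {t1..} \<Longrightarrow> norm (\<mu> t) \<le> B"
    using assms by (auto simp: bounded_pos simp del: atLeast_iff)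
  obtain \<epsilon> where \<epsilon>: "\<epsilon> > 0" "\<And>A :: complex^'n^'n. norm A < \<epsilon> \<Longrightarrow> invertible (mat 1 + A)"
    using invertible_mat_1_plus by blast
  obtain K where K: "K > 0"
    "\<And>(A :: complex^'n^'n) (B :: complex^'n^'n). norm (A ** B) \<le> norm A * norm B * K"
    using mm.pos_bounded by blast
  \<comment> \<open>Chosen so that \<open>norm C < \<delta>\<close> forces
    \<open>norm (C ** \<mu> t) < \<epsilon>\<close> for all \<open>t\<close> at once. The explicit
    solution then exists on the whole half-line, and uniqueness identifies it with \<open>W\<close>
    where \<open>W\<close> is given.\<close>
  define \<delta> where "\<delta> = \<epsilon> / (B * K)"
  have "\<delta> > 0" using \<epsilon> B K by (simp add: \<delta>_def)
  have "\<exists>V. regular_solution P Q R S t1 V \<and> (\<forall>t\<in>{t1..<b}. V t = W t)"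
    if b: "t1 < b" and W: "riccati_solution_on P Q R S {t1..<b} W" and close: "W t1 \<in> ball (Z t1) \<delta>" for b W
  proof -
    let ?C = "W t1 - Z t1"
    have inv: "invertible (mat 1 + ?C ** \<mu> t)" if t: "t \<in> {t1..}" for t
    proof (rule \<epsilon>(2))
      have "norm (?C ** \<mu> t) \<le> norm ?C * norm (\<mu> t) * K" by (rule K)
      also have "\<dots> \<le> norm ?C * B * K"
        using B(2)[OF t] K by (intro mult_right_mono mult_left_mono) auto
      also have "\<dots> < \<delta> * B * K"
        using close B K by (intro mult_strict_right_mono) (auto simp: dist_norm norm_minus_commute)
      also have "\<dots> = \<epsilon>" using B K by (simp add: \<delta>_def)
      finally show "norm (?C ** \<mu> t) < \<epsilon>" .
    qed
    obtain V where V: "riccati_solution_on P Q R S {t1..} V" "V t1 = Z t1 + ?C"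
      using solution_exists[OF order_refl inv] by blast
    have "V t = W t" if "t \<in> {t1..<b}" for t
      by (rule solution_unique[OF V(1) _ W]) (use V that in auto)
    then show ?thesis using V by (auto simp: regular_solution_def)
  qed
  then show ?thesis
    unfolding normal_solution_def using Z \<open>\<delta> > 0\<close>
    by (intro conjI exI[of _ "ball (Z t1) \<delta>"]) auto
qed

text \<open>Normality speaks only of solutions already given on some \<open>[t1, b)\<close>, so one
  with the desired initial value must be supplied before normality can extend it. Since
  \<open>\<mu>\<close> vanishes at \<open>t1\<close> and is continuous, the explicit formula works
  near \<open>t1\<close> for every \<open>C\<close>.\<close>

lemma local_solution_exists:
  obtains b W where "t1 < b" "riccati_solution_on P Q R S {t1..<b} W" "W t1 = Z t1 + C"
proof -
  note solution = that
  obtain \<epsilon> where \<epsilon>: "\<epsilon> > 0" "\<And>A :: complex^'n^'n. norm A < \<epsilon> \<Longrightarrow> invertible (mat 1 + A)"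
    using invertible_mat_1_plus by blast
  have "continuous_on {t1..} (\<lambda>t. C ** \<mu> t)"
    by (intro mm.continuous_on continuous_intros continuous_on_vector_derivative[OF \<mu>_deriv])
  then obtain d where d: "d > 0" "\<And>t. t \<in> {t1..} \<Longrightarrow> dist t t1 < d \<Longrightarrow> norm (C ** \<mu> t) < \<epsilon>"
    using \<epsilon>(1) unfolding continuous_on_iff by (force simp: \<mu>_init dist_norm)
  show thesis
  proof (rule solution_exists[of "{t1..<t1 + d}" C])
    show "invertible (mat 1 + C ** \<mu> t)" if "t \<in> {t1..<t1 + d}" for t
      using that by (intro \<epsilon> d) (auto simp: dist_real_def)
    show thesis if "riccati_solution_on P Q R S {t1..<t1 + d} W" "W t1 = Z t1 + C" for W
      using d(1) that by (intro solution[of "t1 + d" W]) auto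
  qed auto
qed

lemma bounded_if_normal:
  assumes "normal_solution P Q R S t1 Z"
  shows "bounded (\<mu> ` {t1..})"
proof -
  obtain U where U: "open U" "Z t1 \<in> U"
    "\<And>b W. t1 < b \<Longrightarrow> riccati_solution_on P Q R S {t1..<b} W \<Longrightarrow> W t1 \<in> U \<Longrightarrow>
        \<exists>V. regular_solution P Q R S t1 V \<and> (\<forall>t\<in>{t1..<b}. V t = W t)"
    using assms unfolding normal_solution_def by blast
  obtain \<delta> where \<delta>: "\<delta> > 0" "ball (Z t1) \<delta> \<subseteq> U"
    using U by (meson openE)
  define N where "N = real CARD('n)"
  have N: "N > 0" by (simp add: N_def)
  \<comment> \<open>The threshold beyond which the singular perturbation \<open>C\<close> built from
    this entry has norm below \<open>\<delta>\<close>. Normality would continue the local solution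
    starting at \<open>Z t1 + C\<close> up to \<open>t\<close>, where
    \<open>mat 1 + C ** \<mu> t\<close> would have to be invertible.\<close>
  have entry: "norm (\<mu> t $ i $ j) \<le> N * N / \<delta>" if t: "t1 \<le> t" for t i j
  proof (rule ccontr)
    assume "\<not> ?thesis"
    then have large: "N * N / \<delta> < norm (\<mu> t $ i $ j)" by simp
    moreover have "0 \<le> N * N / \<delta>" using N \<delta> by simp
    ultimately have pos: "0 < norm (\<mu> t $ i $ j)" by linarith
    then obtain C where C: "norm C \<le> N * (N / norm (\<mu> t $ i $ j))" "\<not> invertible (mat 1 + C ** \<mu> t)"
      unfolding N_def by (metis singular_perturbation norm_eq_zero less_irrefl)
    have "norm C < \<delta>"
    proof -
      have "N * N < \<delta> * norm (\<mu> t $ i $ j)"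
        using large \<delta> by (simp add: field_simps)
      then have "N * (N / norm (\<mu> t $ i $ j)) < \<delta>"
        using pos by (simp add: field_simps)
      with C(1) show ?thesis by simp
    qed
    obtain b W where W: "t1 < b" "riccati_solution_on P Q R S {t1..<b} W" "W t1 = Z t1 + C"
      by (rule local_solution_exists)
    have "W t1 \<in> U" using \<delta> \<open>norm C < \<delta>\<close> W(3) by (auto simp: dist_norm)
    from U(3)[OF W(1,2) this] obtain V where V: "riccati_solution_on P Q R S {t1..} V" "V t1 = Z t1 + C"
      using W by (auto simp: regular_solution_def)
    from invertible_along_solution[OF V(1) _ t] V(2) C(2) show False by auto
  qed
  show ?thesis
    unfolding bounded_iff using matrix_entry_le_imp_norm_le[OF entry] by auto
qed

end

theorem theorem3p1:
  fixes P Q R S Z \<phi> \<psi> :: "real \<Rightarrow> complex^'n^'n"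
    and t0 t1 :: real
  assumes "continuous_on {t0..} P"
    and "continuous_on {t0..} Q"
    and "continuous_on {t0..} R"
    and "continuous_on {t0..} S"
    and "\<exists>t1'\<ge>t0. has_two_regular_solutions P Q R S t1'"
    and "t0 \<le> t1"
    and "regular_solution P Q R S t1 Z"
    and "is_phi P R Z t1 \<phi>"
    and "is_psi P Q Z t1 \<psi>"
  shows "normal_solution P Q R S t1 Z \<longleftrightarrow> bounded (riccati_mu P \<phi> \<psi> t1 ` {t1..})"
proof -
  have "{t1..} \<subseteq> {t0..}" using assms(6) by auto
  then interpret riccati_linearization P Q R S Z \<phi> \<psi> t1
    using assms by unfold_locales (auto intro: continuous_on_subset)
  show ?thesis
    using normal_if_bounded bounded_if_normal by blast
qed

end
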